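(* Suppose each $f_i:\mathbb{R}^d\to\mathbb{R}$ ($i\in[n]$) is convex and $L$-smooth, let $0<\alpha\le \frac{2}{L}$, $\theta\in(0,1)$, and let $\pi$ be a fixed permutation of $[n]$. Let $(x^t)_{t\ge 0}$ be generated by Prox-DFinito with step-size $\alpha$, damping parameter $\theta$, initialization $\boldsymbol{z}^0\in\mathbb{R}^{nd}$, and cyclic sampling with the order $\pi$. Then for every $k=0,1,2,\dots$ $$\min_{g\in\partial r(x^{kn})}\|\nabla F(x^{kn})+g\|^2\le \frac{C L^2}{(k+1)\theta(1-\theta)},\qquad C=\Big(\frac{2}{\alpha L}\Big)^2\frac{\log(n)+1}{n}\|\boldsymbol{z}^0-\boldsymbol{z}^\star\|_\pi^2 .$$
   Context: Problem: $\min_{x\in\mathbb{R}^d}F(x)+r(x)$ with $F=\frac1n\sum_{i=1}^n f_i$, each $f_i$ differentiable and convex, and $r:\mathbb{R}^d\to\mathbb{R}\cup\{+\infty\}$ convex, closed and proper (not necessarily differentiable), with subdifferential $\partial r$. $[n]=\{1,\dots,n\}$; $L>0$, and $L$-smooth means the gradient is $L$-Lipschitz. $\mathrm{prox}_{\alpha r}(x)=\arg\min_{y}\{\alpha r(y)+\frac12\|y-x\|^2\}$. A minimizer $x^\star$ of $F+r$ is assumed to exist, and $\boldsymbol{z}^\star=\mathrm{col}\{z_1^\star,\dots,z_n^\star\}\in\mathbb{R}^{nd}$ (stacked vector) with $z_i^\star=x^\star-\alpha\nabla f_i(x^\star)$. Order-specific norm: for a permutation $\pi$ of $[n]$ and $\boldsymbol{z}=\mathrm{col}\{z_1,\dots,z_n\}\in\mathbb{R}^{nd}$,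 $\|\boldsymbol{z}\|_\pi^2=\sum_{i=1}^n\frac{i}{n}\|z_{\pi(i)}\|^2$. Prox-DFinito: given $\boldsymbol{z}^0=\mathrm{col}\{z_1^0,\dots,z_n^0\}$, set $\bar z^0=\frac1n\sum_i z_i^0$. For each epoch $k=0,1,2,\dots$: for $t=kn+1,\dots,(k+1)n$, set $x^{t-1}=\mathrm{prox}_{\alpha r}(\bar z^{t-1})$, pick an index $i_t$, set $z_{i_t}^t=x^{t-1}-\alpha\nabla f_{i_t}(x^{t-1})$, $z_i^t=z_i^{t-1}$ for $i\ne i_t$, and $\bar z^t=\bar z^{t-1}+(z_{i_t}^t-z_{i_t}^{t-1})/n$. At the end of the epoch apply the damping step: overwrite $z_i^{(k+1)n}\leftarrow(1-\theta)z_i^{kn}+\theta z_i^{(k+1)n}$ for all $i$ and $\bar z^{(k+1)n}\leftarrow(1-\theta)\bar z^{kn}+\theta\bar z^{(k+1)n}$. Thus $x^{kn}=\mathrm{prox}_{\alpha r}(\bar z^{kn})$ with the damped $\bar z^{kn}$. Cyclic sampling with order $\pi$: $i_{kn+j}=\pi(j)$ for all epochs $k$ and $j\in[n]$. *)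

theory Defs
  imports "HOL-Analysis.Analysis" "HOL-Combinatorics.Permutations"
begin

definition gradient :: "('a::real_inner \<Rightarrow> real) \<Rightarrow> 'a \<Rightarrow> 'a"
  where "gradient f x = (THE D. GDERIV f x :> D)"

definition L_smooth :: "real \<Rightarrow> ('a::real_inner \<Rightarrow> real) \<Rightarrow> bool"
  where "L_smooth L f \<longleftrightarrow> (\<forall>x. f differentiable (at x)) \<and> L-lipschitz_on UNIV (gradient f)"

text \<open>Functions with values in the reals extended by \<open>+\<infinity>\<close> are functions into
  \<^typ>\<open>ereal\<close> that avoid \<open>-\<infinity>\<close>. As usual for such functions, convexity and
  closedness are those of the epigraph.\<close>

definition ext_epigraph :: "('a \<Rightarrow> ereal) \<Rightarrow> ('a \<times> real) set"
  where "ext_epigraph r = {(x, c). r x \<le> ereal c}"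

definition ext_convex :: "('a::real_vector \<Rightarrow> ereal) \<Rightarrow> bool"
  where "ext_convex r \<longleftrightarrow> convex (ext_epigraph r)"

definition ext_closed :: "('a::topological_space \<Rightarrow> ereal) \<Rightarrow> bool"
  where "ext_closed r \<longleftrightarrow> closed (ext_epigraph r)"

definition ext_proper :: "('a \<Rightarrow> ereal) \<Rightarrow> bool"
  where "ext_proper r \<longleftrightarrow> (\<forall>x. r x \<noteq> -\<infinity>) \<and> (\<exists>x. r x \<noteq> \<infinity>)"

definition subdifferential :: "('a::real_inner \<Rightarrow> ereal) \<Rightarrow> 'a \<Rightarrow> 'a set"
  where "subdifferential r x = {g. \<forall>y. r x + ereal (g \<bullet> (y - x)) \<le> r y}"

text \<open>For convex, closed and proper \<open>r\<close> and \<open>\<alpha> > 0\<close> the minimizer exists and is unique,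
  so the choice made by \<^const>\<open>arg_min\<close> is immaterial.\<close>

definition prox :: "real \<Rightarrow> ('a::real_inner \<Rightarrow> ereal) \<Rightarrow> 'a \<Rightarrow> 'a"
  where "prox \<alpha> r x = arg_min (\<lambda>y. ereal \<alpha> * r y + ereal (1/2 * (norm (y - x))\<^sup>2)) (\<lambda>_. True)"

text \<open>A stacked vector \<open>col {z\<^sub>1, \<dots>, z\<^sub>n}\<close> is a function on \<^typ>\<open>nat\<close> of which only the
  values on \<open>{1..n}\<close> are used.\<close>

definition average :: "nat \<Rightarrow> (nat \<Rightarrow> 'a::real_vector) \<Rightarrow> 'a"
  where "average n z = (1 / real n) *\<^sub>R (\<Sum>i\<in>{1..n}. z i)"

definition order_norm :: "nat \<Rightarrow> (nat \<Rightarrow> nat) \<Rightarrow> (nat \<Rightarrow> 'a::real_normed_vector) \<Rightarrow> real"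
  where "order_norm n \<pi> z = sqrt (\<Sum>i\<in>{1..n}. real i / real n * (norm (z (\<pi> i)))\<^sup>2)"

text \<open>The state of the algorithm is the pair of the table \<open>z\<close> and its tracked mean.\<close>

definition dfinito_step ::
  "nat \<Rightarrow> real \<Rightarrow> (nat \<Rightarrow> 'a::real_inner \<Rightarrow> real) \<Rightarrow> ('a \<Rightarrow> ereal) \<Rightarrow> nat
    \<Rightarrow> (nat \<Rightarrow> 'a) \<times> 'a \<Rightarrow> (nat \<Rightarrow> 'a) \<times> 'a"
  where "dfinito_step n \<alpha> f r i s =
    (let z = fst s; zbar = snd s;
         x = prox \<alpha> r zbar;
         w = x - \<alpha> *\<^sub>R gradient (f i) x
     in (z(i := w), zbar + (1 / real n) *\<^sub>R (w - z i)))"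

text \<open>\<open>dfinito_sweep n \<alpha> f r idx k j s\<close>: the state at time \<open>k * n + j\<close>, before any damping at the
  end of epoch \<open>k\<close>, if that epoch starts in state \<open>s\<close>; \<open>idx t\<close> is the index picked at time \<open>t\<close>.\<close>

primrec dfinito_sweep ::
  "nat \<Rightarrow> real \<Rightarrow> (nat \<Rightarrow> 'a::real_inner \<Rightarrow> real) \<Rightarrow> ('a \<Rightarrow> ereal) \<Rightarrow> (nat \<Rightarrow> nat) \<Rightarrow> nat
    \<Rightarrow> nat \<Rightarrow> (nat \<Rightarrow> 'a) \<times> 'a \<Rightarrow> (nat \<Rightarrow> 'a) \<times> 'a"
  where
    "dfinito_sweep n \<alpha> f r idx k 0 s = s"
  | "dfinito_sweep n \<alpha> f r idx k (Suc j) s =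
       dfinito_step n \<alpha> f r (idx (k * n + Suc j)) (dfinito_sweep n \<alpha> f r idx k j s)"

definition damp ::
  "real \<Rightarrow> (nat \<Rightarrow> 'a::real_vector) \<times> 'a \<Rightarrow> (nat \<Rightarrow> 'a) \<times> 'a \<Rightarrow> (nat \<Rightarrow> 'a) \<times> 'a"
  where "damp \<theta> s s' =
    ((\<lambda>i. (1 - \<theta>) *\<^sub>R fst s i + \<theta> *\<^sub>R fst s' i), (1 - \<theta>) *\<^sub>R snd s + \<theta> *\<^sub>R snd s')"

text \<open>\<open>dfinito_epoch n \<alpha> \<theta> f r idx z0 k\<close>: the (damped) state at time \<open>k * n\<close>.\<close>

primrec dfinito_epoch ::
  "nat \<Rightarrow> real \<Rightarrow> real \<Rightarrow> (nat \<Rightarrow> 'a::real_inner \<Rightarrow> real) \<Rightarrow> ('a \<Rightarrow> ereal) \<Rightarrow> (nat \<Rightarrow> nat)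
    \<Rightarrow> (nat \<Rightarrow> 'a) \<Rightarrow> nat \<Rightarrow> (nat \<Rightarrow> 'a) \<times> 'a"
  where
    "dfinito_epoch n \<alpha> \<theta> f r idx z0 0 = (z0, average n z0)"
  | "dfinito_epoch n \<alpha> \<theta> f r idx z0 (Suc k) =
       (let s = dfinito_epoch n \<alpha> \<theta> f r idx z0 k
        in damp \<theta> s (dfinito_sweep n \<alpha> f r idx k n s))"

definition prox_dfinito ::
  "nat \<Rightarrow> real \<Rightarrow> real \<Rightarrow> (nat \<Rightarrow> 'a::real_inner \<Rightarrow> real) \<Rightarrow> ('a \<Rightarrow> ereal) \<Rightarrow> (nat \<Rightarrow> nat)
    \<Rightarrow> (nat \<Rightarrow> 'a) \<Rightarrow> nat \<Rightarrow> 'a"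
  where "prox_dfinito n \<alpha> \<theta> f r idx z0 t =
    prox \<alpha> r (snd (dfinito_sweep n \<alpha> f r idx (t div n) (t mod n)
                    (dfinito_epoch n \<alpha> \<theta> f r idx z0 (t div n))))"

definition cyclic_sampling :: "nat \<Rightarrow> (nat \<Rightarrow> nat) \<Rightarrow> (nat \<Rightarrow> nat) \<Rightarrow> bool"
  where "cyclic_sampling n \<pi> idx \<longleftrightarrow> (\<forall>k. \<forall>j\<in>{1..n}. idx (k * n + j) = \<pi> j)"

end

(* Each gradient step T_i = id - \<alpha> * gradient f_i (with \<alpha> <= 2 / L) and the proximal operator are
   nonexpansive. Updating the component of smallest weight and rotating the weights
   cyclically does not increase the weighted distance of two tables, because by Jensen's inequality
   the squared distance of the new entries is at most the mean squared distance of the old ones.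
   After a full sweep the weights are back in place, so the sweep S is nonexpansive in the
   order-specific norm, and the damped iteration z <- (1 - \<theta>) z + \<theta> S z is a Krasnoselskii-Mann
   iteration: the residual |z - S z| is nonincreasing and its squares are summable, which gives the
   1 / (k + 1) rate. Finally the mean over i of z_i - T_i (prox zbar) equals
   \<alpha> * (gradient F x + g) for a subgradient g at x = prox zbar, and it differs from the
   residual only by the drift of x during one sweep; Cauchy-Schwarz with weights n / i converts
   the plain sum of residuals into the weighted norm at the price of a harmonic number. *)
theory Submission
  imports Defs "HOL-Analysis.Harmonic_Numbers"
begin

subsection \<open>Gradient steps of smooth convex functions\<close>

lemma gradient_eqI:
  assumes "GDERIV f x :> D"
  shows "gradient f x = D"
  unfolding gradient_def
proof (rule the_equality)
  fix E assume "GDERIV f x :> E"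
  then have "(\<lambda>h. h \<bullet> E) = (\<lambda>h. h \<bullet> D)"
    using assms unfolding gderiv_def by (rule has_derivative_unique)
  then have "(E - D) \<bullet> E = (E - D) \<bullet> D"
    by metis
  then show "E = D"
    by (metis inner_diff_right inner_eq_zero_iff right_minus_eq)
qed (fact assms)

text \<open>Riesz representation: in a Euclidean space the linear derivative \<open>f'\<close> is
  the inner product with \<open>adjoint f' 1\<close>.\<close>

lemma GDERIV_gradient:
  fixes f :: "'a::euclidean_space \<Rightarrow> real"
  assumes "f differentiable (at x)"
  shows "GDERIV f x :> gradient f x"
proof -
  obtain f' where f': "(f has_derivative f') (at x)"
    using assms unfolding differentiable_def by blast
  have "f' h = h \<bullet> adjoint f' 1" for h
    using adjoint_works[OF has_derivative_linear[OF f'], of h 1] by (simp add: inner_commute)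
  then have "GDERIV f x :> adjoint f' 1"
    using f' unfolding gderiv_def by (metis (no_types, lifting) ext)
  then show ?thesis
    using gradient_eqI by metis
qed

lemma GDERIV_sum:
  assumes "\<And>i. i \<in> I \<Longrightarrow> GDERIV (f i) x :> D i"
  shows "GDERIV (\<lambda>y. \<Sum>i\<in>I. f i y) x :> (\<Sum>i\<in>I. D i)"
  using assms unfolding gderiv_def inner_sum_right by (intro has_derivative_sum) auto

lemma GDERIV_line:
  assumes "GDERIV f (x + t *\<^sub>R d) :> D"
  shows "((\<lambda>t. f (x + t *\<^sub>R d)) has_real_derivative D \<bullet> d) (at t)"
proof -
  have "((\<lambda>t. x + t *\<^sub>R d) has_derivative (\<lambda>h. h *\<^sub>R d)) (at t)"
    by (auto intro!: derivative_eq_intros)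
  from has_derivative_compose[OF this assms[unfolded gderiv_def]]
  show ?thesis
    by (simp add: has_field_derivative_def inner_commute mult_commute_abs)
qed

text \<open>The bound passes to the limit of the right difference quotients. This serves both the
  gradient inequality of convex functions and the first-order condition at minimizers.\<close>

lemma GDERIV_upper_bound:
  assumes D: "GDERIV f x :> D"
    and le: "\<And>t. 0 < t \<Longrightarrow> t < 1 \<Longrightarrow> f (x + t *\<^sub>R d) - f x \<le> t * c"
  shows "D \<bullet> d \<le> c"
proof -
  have "((\<lambda>t. f (x + t *\<^sub>R d)) has_real_derivative D \<bullet> d) (at 0)"
    using D by (intro GDERIV_line) simp
  then have "((\<lambda>t. (f (x + t *\<^sub>R d) - f x) / t) \<longlongrightarrow> D \<bullet> d) (at 0)"
    by (simp add: DERIV_def)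
  then have lim: "((\<lambda>t. (f (x + t *\<^sub>R d) - f x) / t) \<longlongrightarrow> D \<bullet> d) (at_right 0)"
    by (rule tendsto_mono[rotated]) (simp add: at_le)
  have "\<forall>\<^sub>F t in at_right (0::real). 0 < t \<and> t < 1"
    using eventually_at_right_real[of 0 "1::real"] by (simp add: greaterThanLessThan_iff)
  then have "\<forall>\<^sub>F t in at_right 0. (f (x + t *\<^sub>R d) - f x) / t \<le> c"
    by eventually_elim (use le in \<open>simp add: divide_le_eq mult.commute\<close>)
  then show ?thesis
    by (rule tendsto_upperbound[OF lim]) simp
qed

lemma convex_on_above_gradient:
  assumes "convex_on UNIV f" and D: "GDERIV f x :> D"
  shows "f x + D \<bullet> (y - x) \<le> f y"
proof -
  have "f (x + t *\<^sub>R (y - x)) - f x \<le> t * (f y - f x)" if "0 < t" "t < 1" for t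
  proof -
    have "f ((1 - t) *\<^sub>R x + t *\<^sub>R y) \<le> (1 - t) * f x + t * f y"
      using that by (intro convex_onD[OF assms(1)]) auto
    moreover have "(1 - t) *\<^sub>R x + t *\<^sub>R y = x + t *\<^sub>R (y - x)"
      by (simp add: algebra_simps)
    ultimately show ?thesis
      by (simp add: algebra_simps)
  qed
  from GDERIV_upper_bound[OF D this] show ?thesis
    by simp
qed

text \<open>Removing the linear part and the quadratic term from \<open>f\<close> along the segment
  leaves \<open>h\<close>, whose derivative is nonpositive by Cauchy-Schwarz and the Lipschitz
  bound.\<close>

lemma descent_lemma:
  assumes G: "\<And>x. GDERIV f x :> G x" and lip: "L-lipschitz_on UNIV G"
  shows "f y \<le> f x + G x \<bullet> (y - x) + L / 2 * (norm (y - x))\<^sup>2"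
proof -
  define d where "d = y - x"
  define h where "h t = f (x + t *\<^sub>R d) - t * (G x \<bullet> d) - t\<^sup>2 * (L / 2 * (norm d)\<^sup>2)" for t
  have "h 0 \<ge> h 1"
  proof (rule DERIV_nonpos_imp_nonincreasing[where f = h])
    fix t :: real assume "0 \<le> t"
    define h' where "h' = G (x + t *\<^sub>R d) \<bullet> d - G x \<bullet> d - t * (L * (norm d)\<^sup>2)"
    have "(h has_real_derivative h') (at t)"
      unfolding h_def h'_def
      by (rule derivative_eq_intros GDERIV_line G refl | simp)+
    moreover have "h' \<le> 0"
    proof -
      have "(G (x + t *\<^sub>R d) - G x) \<bullet> d \<le> norm (G (x + t *\<^sub>R d) - G x) * norm d"
        by (rule norm_cauchy_schwarz)
      also have "norm (G (x + t *\<^sub>R d) - G x) \<le> L * (t * norm d)"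
        using lipschitz_onD[OF lip, of "x + t *\<^sub>R d" x] \<open>0 \<le> t\<close> by (simp add: dist_norm)
      finally show ?thesis
        by (simp add: h'_def inner_diff_left power2_eq_square mult_right_mono algebra_simps)
    qed
    ultimately show "\<exists>y. DERIV h t :> y \<and> y \<le> 0"
      by blast
  qed simp
  then show ?thesis
    by (simp add: h_def d_def)
qed

text \<open>Towards the Baillon--Haddad inequality: the tilted function \<open>f - \<langle>G x, \<cdot>\<rangle>\<close> is minimal at \<open>x\<close>;
  compare its values at \<open>x\<close> and at one gradient step from \<open>y\<close>.\<close>

lemma gradient_gap:
  assumes f: "convex_on UNIV f" and G: "\<And>x. GDERIV f x :> G x"
    and lip: "L-lipschitz_on UNIV G" and L: "L > 0"
  shows "f x + G x \<bullet> (y - x) + 1 / (2 * L) * (norm (G y - G x))\<^sup>2 \<le> f y"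
proof -
  define e where "e = G y - G x"
  \<comment> \<open>\<open>e\<close> is the gradient of the tilted function at \<open>y\<close>. The
    step length \<open>1 / L\<close> minimizes the quadratic upper bound from the descent lemma,
    which produces the constant \<open>1 / (2 * L)\<close>.\<close>
  define u where "u = y - (1 / L) *\<^sub>R e"
  have "f x + G x \<bullet> (u - x) \<le> f u"
    by (rule convex_on_above_gradient[OF f G])
  moreover have "f u \<le> f y + G y \<bullet> (u - y) + L / 2 * (norm (u - y))\<^sup>2"
    by (rule descent_lemma[OF G lip])
  moreover have "G x \<bullet> (u - x) = G x \<bullet> (y - x) - (1 / L) * (G x \<bullet> e)"
    by (simp add: u_def inner_diff_right)
  moreover have "G y \<bullet> (u - y) = - (1 / L) * (G y \<bullet> e)"
    by (simp add: u_def)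
  moreover have "L / 2 * (norm (u - y))\<^sup>2 = 1 / (2 * L) * (norm e)\<^sup>2"
    using L by (simp add: u_def power2_eq_square field_simps)
  moreover have "(1 / L) * (G y \<bullet> e) - (1 / L) * (G x \<bullet> e) = 2 * (1 / (2 * L) * (norm e)\<^sup>2)"
    using L by (simp add: e_def power2_norm_eq_inner inner_diff_left field_simps)
  ultimately show ?thesis
    unfolding e_def by linarith
qed

text \<open>Adding the gap inequality to its copy with \<open>x\<close> and \<open>y\<close>
  exchanged cancels the function values.\<close>

lemma gradient_cocoercive:
  assumes f: "convex_on UNIV f" and G: "\<And>x. GDERIV f x :> G x"
    and lip: "L-lipschitz_on UNIV G" and L: "L > 0"
  shows "(norm (G x - G y))\<^sup>2 \<le> L * ((G x - G y) \<bullet> (x - y))"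
proof -
  have "f x + G x \<bullet> (y - x) + 1 / (2 * L) * (norm (G x - G y))\<^sup>2 \<le> f y"
    "f y + G y \<bullet> (x - y) + 1 / (2 * L) * (norm (G x - G y))\<^sup>2 \<le> f x"
    using gradient_gap[OF assms, of x y] gradient_gap[OF assms, of y x]
    by (simp_all add: norm_minus_commute)
  moreover have "(G x - G y) \<bullet> (x - y) = - (G x \<bullet> (y - x)) - G y \<bullet> (x - y)"
    by (simp add: algebra_simps)
  moreover have "(norm (G x - G y))\<^sup>2 = L * (2 * (1 / (2 * L) * (norm (G x - G y))\<^sup>2))"
    using L by simp
  ultimately show ?thesis
    using L by (smt (verit) mult_left_mono)
qed

text \<open>When the square is expanded, the cross term absorbs the quadratic term in
  \<open>g\<close>, by cocoercivity and \<open>\<alpha> * L \<le> 2\<close>.\<close>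

lemma gradient_step_nonexpansive:
  assumes f: "convex_on UNIV f" and G: "\<And>x. GDERIV f x :> G x"
    and lip: "L-lipschitz_on UNIV G" and L: "L > 0" and \<alpha>: "0 < \<alpha>" "\<alpha> \<le> 2 / L"
  shows "norm ((x - \<alpha> *\<^sub>R G x) - (y - \<alpha> *\<^sub>R G y)) \<le> norm (x - y)"
proof -
  define g d where "g = G x - G y" and "d = x - y"
  have co: "(norm g)\<^sup>2 \<le> L * (g \<bullet> d)"
    unfolding g_def d_def by (rule gradient_cocoercive[OF f G lip L])
  then have "0 \<le> L * (g \<bullet> d)"
    by (rule order_trans[rotated]) simp
  then have pos: "0 \<le> g \<bullet> d"
    using L by (simp add: zero_le_mult_iff)
  have "\<alpha> * (norm g)\<^sup>2 \<le> \<alpha> * (L * (g \<bullet> d))"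
    using co \<alpha>(1) by simp
  also have "\<dots> = (\<alpha> * L) * (g \<bullet> d)"
    by simp
  also have "\<dots> \<le> 2 * (g \<bullet> d)"
    using L \<alpha>(2) pos by (intro mult_right_mono) (simp add: field_simps)
  finally have "\<alpha> * (\<alpha> * (norm g)\<^sup>2) \<le> \<alpha> * (2 * (g \<bullet> d))"
    using \<alpha>(1) by simp
  moreover have "(norm (d - \<alpha> *\<^sub>R g))\<^sup>2 = (norm d)\<^sup>2 - \<alpha> * (2 * (g \<bullet> d)) + \<alpha> * (\<alpha> * (norm g)\<^sup>2)"
    by (simp add: power2_norm_eq_inner algebra_simps inner_commute)
  ultimately have "(norm (d - \<alpha> *\<^sub>R g))\<^sup>2 \<le> (norm d)\<^sup>2"
    by linarith
  then have "norm (d - \<alpha> *\<^sub>R g) \<le> norm d"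
    by (rule power2_le_imp_le) simp
  then show ?thesis
    by (simp add: d_def g_def algebra_simps)
qed

subsection \<open>Subgradients and proximal operators\<close>

lemma subgradient_imp_finite:
  assumes "ext_proper r" "g \<in> subdifferential r x"
  obtains a where "r x = ereal a"
proof -
  obtain y where "r y \<noteq> \<infinity>"
    using assms(1) unfolding ext_proper_def by blast
  moreover have "r x + ereal (g \<bullet> (y - x)) \<le> r y"
    using assms(2) unfolding subdifferential_def by blast
  ultimately have "r x \<noteq> \<infinity>"
    by auto
  then show ?thesis
    using assms(1) that unfolding ext_proper_def by (cases "r x") auto
qed

text \<open>An intersection of closed sets, half-spaces where both values are finite. Closedness is
  what lets the minimum over subgradients in the final theorem be attained.\<close>

lemma closed_subdifferential:
  assumes "ext_proper r"
  shows "closed (subdifferential r x)"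
proof -
  have "closed {g. r x + ereal (g \<bullet> (y - x)) \<le> r y}" for y
  proof (cases "r x"; cases "r y")
    fix a b assume "r x = ereal a" "r y = ereal b"
    then show ?thesis
      by (auto intro!: closed_Collect_le continuous_intros)
  qed (use assms in \<open>auto simp: ext_proper_def\<close>)
  moreover have "subdifferential r x = (\<Inter>y. {g. r x + ereal (g \<bullet> (y - x)) \<le> r y})"
    unfolding subdifferential_def by auto
  ultimately show ?thesis
    by auto
qed

text \<open>Convexity of the epigraph bounds \<open>r\<close> on the segment from \<open>p\<close>
  to \<open>y\<close> by its chord, so minimality bounds the growth of \<open>- G\<close> there by
  the slope of the chord. Applied to \<open>F\<close> at \<open>xstar\<close> and to the quadratic
  term of the proximal objective.\<close>

lemma minimizer_imp_subgradient:
  assumes r: "ext_convex r" "ext_proper r" and D: "GDERIV G p :> D"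
    and min: "\<And>y. ereal (G p) + r p \<le> ereal (G y) + r y"
  shows "- D \<in> subdifferential r p"
proof -
  obtain y0 where "r y0 \<noteq> \<infinity>"
    using r(2) unfolding ext_proper_def by blast
  then have "r p \<noteq> \<infinity>"
    using min[of y0] by auto
  then obtain a where a: "r p = ereal a"
    using r(2) unfolding ext_proper_def by (cases "r p") auto
  have "r p + ereal (- D \<bullet> (y - p)) \<le> r y" for y
  proof (cases "r y")
    case (real b)
    have "- G (p + t *\<^sub>R (y - p)) - - G p \<le> t * (b - a)" if "0 < t" "t < 1" for t
    proof -
      have "(1 - t) *\<^sub>R (p, a) + t *\<^sub>R (y, b) \<in> ext_epigraph r"
        using that real a r(1) unfolding ext_convex_def
        by (intro convexD_alt) (auto simp: ext_epigraph_def)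
      moreover have "(1 - t) *\<^sub>R p + t *\<^sub>R y = p + t *\<^sub>R (y - p)"
        by (simp add: algebra_simps)
      ultimately have "r (p + t *\<^sub>R (y - p)) \<le> ereal ((1 - t) * a + t * b)"
        by (simp add: ext_epigraph_def)
      then have "ereal (G p) + r p \<le> ereal (G (p + t *\<^sub>R (y - p))) + ereal ((1 - t) * a + t * b)"
        using min[of "p + t *\<^sub>R (y - p)"] by (meson add_left_mono order_trans)
      then show ?thesis
        by (simp add: a algebra_simps)
    qed
    from GDERIV_upper_bound[OF GDERIV_minus[OF D] this] show ?thesis
      by (simp add: real a)
  qed (use r(2) in \<open>auto simp: ext_proper_def\<close>)
  then show ?thesis
    unfolding subdifferential_def by blast
qed

lemma subgradient_monotone:
  assumes "ext_proper r" "g \<in> subdifferential r p" "h \<in> subdifferential r q"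
  shows "0 \<le> (g - h) \<bullet> (p - q)"
proof -
  obtain a b where ab: "r p = ereal a" "r q = ereal b"
    using assms(2,3) by (auto elim!: subgradient_imp_finite[OF assms(1)])
  have "r p + ereal (g \<bullet> (q - p)) \<le> r q" "r q + ereal (h \<bullet> (p - q)) \<le> r p"
    using assms(2,3) unfolding subdifferential_def by blast+
  then show ?thesis
    by (simp add: ab algebra_simps)
qed

text \<open>Monotonicity gives firm nonexpansiveness, and Cauchy-Schwarz finishes. The form with
  inclusions instead of \<open>prox\<close> also yields uniqueness: \<open>x = y\<close> forces
  \<open>p = q\<close>.\<close>

lemma resolvent_nonexpansive:
  assumes r: "ext_proper r" and \<alpha>: "0 < \<alpha>"
    and p: "(1 / \<alpha>) *\<^sub>R (x - p) \<in> subdifferential r p"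
    and q: "(1 / \<alpha>) *\<^sub>R (y - q) \<in> subdifferential r q"
  shows "norm (p - q) \<le> norm (x - y)"
proof -
  have "0 \<le> ((1 / \<alpha>) *\<^sub>R ((x - p) - (y - q))) \<bullet> (p - q)"
    using subgradient_monotone[OF r p q] by (simp only: scaleR_diff_right)
  then have "0 \<le> ((x - p) - (y - q)) \<bullet> (p - q)"
    using \<alpha> by (simp add: zero_le_divide_iff)
  moreover have "(x - y) \<bullet> (p - q) = ((x - p) - (y - q)) \<bullet> (p - q) + (p - q) \<bullet> (p - q)"
    by (simp flip: inner_add_left)
  ultimately have "norm (p - q) * norm (p - q) \<le> (x - y) \<bullet> (p - q)"
    by (simp flip: power2_eq_square add: power2_norm_eq_inner)
  also have "\<dots> \<le> norm (x - y) * norm (p - q)"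
    by (rule norm_cauchy_schwarz)
  finally show ?thesis
    by (cases "norm (p - q) = 0") (simp_all add: mult_le_cancel_right)
qed

text \<open>A subgradient at some point yields an affine minorant of \<open>r\<close>, which makes the sublevel
  sets of the proximal objective on the epigraph compact.\<close>

lemma prox_objective_attains_min:
  fixes r :: "'a::euclidean_space \<Rightarrow> ereal"
  assumes r: "ext_closed r" "ext_proper r" and \<alpha>: "0 < \<alpha>" and g: "g \<in> subdifferential r q"
  shows "\<exists>p. \<forall>y. ereal \<alpha> * r p + ereal (1/2 * (norm (p - x))\<^sup>2)
    \<le> ereal \<alpha> * r y + ereal (1/2 * (norm (y - x))\<^sup>2)"
proof -
  obtain a where a: "r q = ereal a"
    by (rule subgradient_imp_finite[OF r(2) g])
  \<comment> \<open>On pairs from the epigraph the objective is real-valued and continuous, whereas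
    \<open>r\<close> may be infinite or discontinuous.\<close>
  define obj where "obj v = \<alpha> * snd v + 1/2 * (norm (fst v - x))\<^sup>2" for v :: "'a \<times> real"
  define M where "M = obj (q, a)"
  define K where "K = ext_epigraph r \<inter> {v. obj v \<le> M}"
  define e where "e = a + g \<bullet> (x - q)"
  \<comment> \<open>For \<open>t > 1\<close>, dividing the inequality \<open>quad\<close> below by
    \<open>t\<close> bounds \<open>t\<close> by the second summand; the summand 1 covers
    \<open>t \<le> 1\<close>.\<close>
  define B where "B = 1 + 2 * (\<bar>M - \<alpha> * e\<bar> + \<alpha> * norm g)"
  have obj_cont: "continuous_on S obj" for S
    unfolding obj_def by (intro continuous_intros)
  have minorant: "e - norm g * norm (y - x) \<le> c" if "(y, c) \<in> ext_epigraph r" for y c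
  proof -
    have "r q + ereal (g \<bullet> (y - q)) \<le> r y"
      using g unfolding subdifferential_def by blast
    also have "\<dots> \<le> ereal c"
      using that by (simp add: ext_epigraph_def)
    finally have "a + g \<bullet> (y - q) \<le> c"
      by (simp add: a)
    moreover have "- (norm g * norm (y - x)) \<le> g \<bullet> (y - x)"
      using Cauchy_Schwarz_ineq2[of g "y - x"] by linarith
    ultimately show ?thesis
      by (simp add: e_def inner_diff_right)
  qed
  have "v \<in> cball x B \<times> {e - norm g * B..M / \<alpha>}" if "v \<in> K" for v
  proof -
    obtain y c where v: "v = (y, c)"
      by (cases v)
    define t where "t = norm (y - x)"
    have c: "e - norm g * t \<le> c" and M: "\<alpha> * c + 1/2 * t\<^sup>2 \<le> M"
      using that minorant[of y c] by (auto simp: K_def v obj_def t_def)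
    have "\<alpha> * (e - norm g * t) \<le> \<alpha> * c"
      using c \<alpha> by (intro mult_left_mono) auto
    then have quad: "t\<^sup>2 \<le> 2 * ((M - \<alpha> * e) + \<alpha> * norm g * t)"
      using M by (simp add: algebra_simps)
    have "t \<le> B"
    proof (rule ccontr)
      assume "\<not> t \<le> B"
      moreover define b where "b = \<bar>M - \<alpha> * e\<bar> + \<alpha> * norm g"
      moreover have "0 \<le> b"
        using \<alpha> by (simp add: b_def)
      ultimately have t: "1 < t" "2 * (\<bar>M - \<alpha> * e\<bar> + \<alpha> * norm g) < t"
        by (simp_all add: B_def)
      have "2 * ((M - \<alpha> * e) + \<alpha> * norm g * t) \<le> 2 * (\<bar>M - \<alpha> * e\<bar> * t + \<alpha> * norm g * t)"
        using t(1) mult_left_mono[of 1 t "\<bar>M - \<alpha> * e\<bar>"] by simp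
      also have "\<dots> = 2 * (\<bar>M - \<alpha> * e\<bar> + \<alpha> * norm g) * t"
        by (simp add: algebra_simps)
      also have "\<dots> < t * t"
        using t by (intro mult_strict_right_mono) auto
      finally show False
        using quad by (simp add: power2_eq_square)
    qed
    moreover have "e - norm g * B \<le> c"
      using c mult_left_mono[OF \<open>t \<le> B\<close>, of "norm g"] by simp
    moreover have "c \<le> M / \<alpha>"
    proof -
      have "\<alpha> * c \<le> M"
        using M zero_le_power2[of t] by linarith
      then show ?thesis
        using \<alpha> by (simp add: field_simps)
    qed
    ultimately show ?thesis
      by (simp add: v t_def dist_norm norm_minus_commute)
  qed
  then have "bounded K"
    by (intro bounded_subset[OF bounded_Times[OF bounded_cball bounded_closed_interval]]) auto
  moreover have "closed K"
    unfolding K_def using r(1) unfolding ext_closed_def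
    by (intro closed_Int closed_Collect_le obj_cont continuous_on_const)
  ultimately have "compact K"
    by (simp add: compact_eq_bounded_closed)
  moreover have qK: "(q, a) \<in> K"
    by (simp add: K_def M_def ext_epigraph_def a)
  ultimately obtain v where v: "v \<in> K" "\<And>w. w \<in> K \<Longrightarrow> obj v \<le> obj w"
    using continuous_attains_inf[of K obj] obj_cont by blast
  obtain p c where pc: "v = (p, c)"
    by (cases v)
  \<comment> \<open>The height \<open>c\<close> may lie above \<open>r p\<close>, so this is only an
    inequality; it suffices because \<open>obj v\<close> is a lower bound for the objective
    everywhere.\<close>
  have obj_p: "ereal \<alpha> * r p + ereal (1/2 * (norm (p - x))\<^sup>2) \<le> ereal (obj v)"
  proof -
    have "r p \<le> ereal c"
      using v(1) by (simp add: pc K_def ext_epigraph_def)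
    then show ?thesis
      using \<alpha> by (cases "r p") (auto simp: obj_def pc)
  qed
  have "ereal (obj v) \<le> ereal \<alpha> * r y + ereal (1/2 * (norm (y - x))\<^sup>2)" for y
  proof (cases "r y")
    case (real b)
    have "obj v \<le> obj (y, b)"
    proof (cases "(y, b) \<in> K")
      case False
      then have "M < obj (y, b)"
        using real by (simp add: K_def ext_epigraph_def)
      then show ?thesis
        using v(2)[OF qK] by (simp add: M_def)
    qed (rule v(2))
    then show ?thesis
      by (simp add: real obj_def)
  qed (use r(2) \<alpha> in \<open>auto simp: ext_proper_def\<close>)
  with obj_p show ?thesis
    by (meson order_trans)
qed

text \<open>Divided by \<open>\<alpha>\<close>, the proximal objective is \<open>r\<close> plus a
  quadratic with gradient \<open>(1 / \<alpha>) *\<^sub>R (p - x)\<close> at \<open>p\<close>, so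
  the first-order condition applies. The subgradient \<open>g\<close> enters through the existence
  of the minimizer.\<close>

lemma prox_subgradient:
  fixes r :: "'a::euclidean_space \<Rightarrow> ereal"
  assumes r: "ext_convex r" "ext_closed r" "ext_proper r" and \<alpha>: "0 < \<alpha>"
    and g: "g \<in> subdifferential r q"
  shows "(1 / \<alpha>) *\<^sub>R (x - prox \<alpha> r x) \<in> subdifferential r (prox \<alpha> r x)"
proof -
  define p where "p = prox \<alpha> r x"
  have "\<exists>p. is_arg_min (\<lambda>y. ereal \<alpha> * r y + ereal (1/2 * (norm (y - x))\<^sup>2)) (\<lambda>_. True) p"
    using prox_objective_attains_min[OF r(2,3) \<alpha> g] by (simp add: is_arg_min_def not_less)
  then have "is_arg_min (\<lambda>y. ereal \<alpha> * r y + ereal (1/2 * (norm (y - x))\<^sup>2)) (\<lambda>_. True) p"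
    unfolding p_def prox_def arg_min_def by (rule someI_ex)
  then have min: "ereal \<alpha> * r p + ereal (1/2 * (norm (p - x))\<^sup>2)
      \<le> ereal \<alpha> * r y + ereal (1/2 * (norm (y - x))\<^sup>2)" for y
    by (simp add: is_arg_min_def not_less)
  have scale: "a + 1 / (2 * \<alpha>) * u \<le> b + 1 / (2 * \<alpha>) * v"
    if "\<alpha> * a + 1/2 * u \<le> \<alpha> * b + 1/2 * v" for a b u v :: real
    using divide_right_mono[OF that, of \<alpha>] \<alpha> by (simp add: add_divide_distrib)
  define G where "G y = 1 / (2 * \<alpha>) * ((y - x) \<bullet> (y - x))" for y
  have "- ((1 / \<alpha>) *\<^sub>R (p - x)) \<in> subdifferential r p"
  proof (rule minimizer_imp_subgradient[OF r(1,3)])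
    show "GDERIV G p :> (1 / \<alpha>) *\<^sub>R (p - x)"
      unfolding G_def gderiv_def using \<alpha>
      by (auto intro!: derivative_eq_intros simp: inner_commute)
    show "ereal (G p) + r p \<le> ereal (G y) + r y" for y
    proof (cases "r p"; cases "r y")
      fix a b assume ab: "r p = ereal a" "r y = ereal b"
      then have "\<alpha> * a + 1/2 * (norm (p - x))\<^sup>2 \<le> \<alpha> * b + 1/2 * (norm (y - x))\<^sup>2"
        using min[of y] by simp
      then show ?thesis
        using scale[of a "(norm (p - x))\<^sup>2" b "(norm (y - x))\<^sup>2"]
        by (simp add: ab G_def power2_norm_eq_inner)
    next
      fix b assume "r p = \<infinity>" "r y = ereal b"
      with min[of y] \<alpha> show ?thesis
        by simp
    qed (use r(3) in \<open>auto simp: ext_proper_def\<close>)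
  qed
  then show ?thesis
    by (simp add: p_def scaleR_diff_right)
qed

subsection \<open>Nonexpansive sweeps\<close>

lemma average_diff: "average n y - average n z = average n (\<lambda>i. y i - z i)"
  by (simp add: average_def sum_subtractf scaleR_diff_right)

lemma average_update:
  assumes "i \<in> {1..n}"
  shows "average n (z(i := w)) = average n z + (1 / real n) *\<^sub>R (w - z i)"
proof -
  have "(\<Sum>j\<in>{1..n}. (z(i := w)) j) = (\<Sum>j\<in>{1..n}. z j) + (w - z i)"
    using assms by (simp add: sum.remove[of _ i])
  then show ?thesis
    by (simp add: average_def scaleR_add_right)
qed

lemma average_relax:
  "average n (\<lambda>i. (1 - \<theta>) *\<^sub>R y i + \<theta> *\<^sub>R z i) = (1 - \<theta>) *\<^sub>R average n y + \<theta> *\<^sub>R average n z"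
  by (simp add: average_def sum.distrib scaleR_add_right mult.commute flip: scaleR_sum_right)

lemma average_permute:
  assumes "\<pi> permutes {1..n}"
  shows "average n (\<lambda>i. z (\<pi> i)) = average n z"
  using sum.permute[OF assms, of z] by (simp add: average_def o_def)

lemma norm_average_le: "norm (average n z) \<le> (1 / real n) * (\<Sum>i\<in>{1..n}. norm (z i))"
  unfolding average_def norm_scaleR by (intro mult_mono norm_sum) auto

text \<open>Jensen's inequality for the square, obtained from the triangle inequality and
  Cauchy-Schwarz.\<close>

lemma norm_average_power2_le:
  "(norm (average n z))\<^sup>2 \<le> (1 / real n) * (\<Sum>i\<in>{1..n}. (norm (z i))\<^sup>2)"
proof (cases "n = 0")
  case False
  have "(norm (average n z))\<^sup>2 \<le> ((1 / real n) * (\<Sum>i\<in>{1..n}. norm (z i)))\<^sup>2"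
    by (intro power_mono norm_average_le) simp
  also have "\<dots> \<le> (1 / real n)\<^sup>2 * (real n * (\<Sum>i\<in>{1..n}. (norm (z i))\<^sup>2))"
    using sum_squared_le_sum_of_squares[of "\<lambda>i. norm (z i)" "{1..n}"]
    unfolding power_mult_distrib by (intro mult_left_mono) (auto simp: mult.commute)
  also have "\<dots> = (1 / real n) * (\<Sum>i\<in>{1..n}. (norm (z i))\<^sup>2)"
    using False by (simp add: power2_eq_square)
  finally show ?thesis .
qed (simp add: average_def)

section \<open>The order-specific norm as a weighted Euclidean norm\<close>

lemma order_norm_power2:
  "(order_norm n \<pi> z)\<^sup>2 = (\<Sum>i\<in>{1..n}. real i / real n * (norm (z (\<pi> i)))\<^sup>2)"
  unfolding order_norm_def by (simp add: sum_nonneg)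

lemma order_norm_nonneg: "0 \<le> order_norm n \<pi> z"
  unfolding order_norm_def by (simp add: sum_nonneg)

text \<open>Absorbing the square roots of the weights into the entries reduces the triangle
  inequality to that of \<open>L2_set\<close>.\<close>

lemma order_norm_L2_set:
  "order_norm n \<pi> z = L2_set (\<lambda>i. norm (sqrt (real i / real n) *\<^sub>R z (\<pi> i))) {1..n}"
  unfolding order_norm_def L2_set_def by (simp add: power_mult_distrib)

lemma order_norm_scaleR: "order_norm n \<pi> (\<lambda>i. c *\<^sub>R z i) = \<bar>c\<bar> * order_norm n \<pi> z"
proof -
  have "order_norm n \<pi> (\<lambda>i. c *\<^sub>R z i)
      = sqrt (c\<^sup>2 * (\<Sum>i\<in>{1..n}. real i / real n * (norm (z (\<pi> i)))\<^sup>2))"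
    by (simp add: order_norm_def power_mult_distrib sum_distrib_left mult_ac)
  then show ?thesis
    by (simp add: order_norm_def real_sqrt_mult)
qed

lemma order_norm_triangle:
  "order_norm n \<pi> (\<lambda>i. y i + z i) \<le> order_norm n \<pi> y + order_norm n \<pi> z"
proof -
  have "order_norm n \<pi> (\<lambda>i. y i + z i) \<le> L2_set (\<lambda>i. norm (sqrt (real i / real n) *\<^sub>R y (\<pi> i))
      + norm (sqrt (real i / real n) *\<^sub>R z (\<pi> i))) {1..n}"
    unfolding order_norm_L2_set scaleR_add_right by (intro L2_set_mono norm_triangle_ineq) auto
  also have "\<dots> \<le> order_norm n \<pi> y + order_norm n \<pi> z"
    unfolding order_norm_L2_set by (rule L2_set_triangle_ineq)
  finally show ?thesis .
qed

text \<open>Strong convexity of the squared norm in exact form; the negative term is the source of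
  the factor \<open>\<theta> * (1 - \<theta>)\<close> in the rate.\<close>

lemma norm_relax_power2:
  fixes u v :: "'a::real_inner"
  shows "(norm ((1 - \<theta>) *\<^sub>R u + \<theta> *\<^sub>R v))\<^sup>2
    = (1 - \<theta>) * (norm u)\<^sup>2 + \<theta> * (norm v)\<^sup>2 - \<theta> * (1 - \<theta>) * (norm (u - v))\<^sup>2"
  by (simp add: power2_norm_eq_inner algebra_simps inner_commute)

lemma order_norm_relax_power2:
  fixes y z :: "nat \<Rightarrow> 'a::real_inner"
  shows "(order_norm n \<pi> (\<lambda>i. (1 - \<theta>) *\<^sub>R y i + \<theta> *\<^sub>R z i))\<^sup>2
    = (1 - \<theta>) * (order_norm n \<pi> y)\<^sup>2 + \<theta> * (order_norm n \<pi> z)\<^sup>2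
      - \<theta> * (1 - \<theta>) * (order_norm n \<pi> (\<lambda>i. y i - z i))\<^sup>2"
  unfolding order_norm_power2 norm_relax_power2 sum_distrib_left
    sum.distrib [symmetric] sum_subtractf [symmetric]
  by (intro sum.cong refl) (simp add: algebra_simps add_divide_distrib diff_divide_distrib)

lemma sum_le_harmonic_order_norm:
  assumes n: "n \<ge> 1"
  shows "(\<Sum>i\<in>{1..n}. norm (z (\<pi> i)))\<^sup>2 \<le> real n * (ln (real n) + 1) * (order_norm n \<pi> z)\<^sup>2"
proof -
  have "norm (z (\<pi> i)) = sqrt (real n / real i) * (sqrt (real i / real n) * norm (z (\<pi> i)))"
    if "i \<in> {1..n}" for i
    using that by (simp add: real_sqrt_divide)
  then have "(\<Sum>i\<in>{1..n}. norm (z (\<pi> i)))\<^sup>2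
      = (\<Sum>i\<in>{1..n}. sqrt (real n / real i) * (sqrt (real i / real n) * norm (z (\<pi> i))))\<^sup>2"
    by (metis (no_types, lifting) sum.cong)
  also have "\<dots> \<le> (\<Sum>i\<in>{1..n}. (sqrt (real n / real i))\<^sup>2)
      * (\<Sum>i\<in>{1..n}. (sqrt (real i / real n) * norm (z (\<pi> i)))\<^sup>2)"
    by (rule Cauchy_Schwarz_ineq_sum)
  also have "(\<Sum>i\<in>{1..n}. (sqrt (real n / real i))\<^sup>2) = real n * harm n"
    by (simp add: harm_def sum_distrib_left divide_inverse)
  also have "(\<Sum>i\<in>{1..n}. (sqrt (real i / real n) * norm (z (\<pi> i)))\<^sup>2) = (order_norm n \<pi> z)\<^sup>2"
    by (simp add: order_norm_power2 power_mult_distrib)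
  \<comment> \<open>The sequence \<open>harm n - ln n\<close> is nonincreasing and has the value 1
    at \<open>n = 1\<close>.\<close>
  also have "real n * harm n * (order_norm n \<pi> z)\<^sup>2
      \<le> real n * (ln (real n) + 1) * (order_norm n \<pi> z)\<^sup>2"
    using euler_mascheroni_sequence_decreasing[of 1 n] n
    by (intro mult_right_mono mult_left_mono) (simp_all add: harm_expand)
  finally show ?thesis .
qed

section \<open>Cyclic sweeps of abstract nonexpansive maps\<close>

locale nonexpansive_sweep =
  fixes n :: nat and \<pi> :: "nat \<Rightarrow> nat" and T :: "nat \<Rightarrow> 'a::real_inner \<Rightarrow> 'a" and P :: "'a \<Rightarrow> 'a"
  assumes n_pos: "n \<ge> 1" and perm: "\<pi> permutes {1..n}"
    and T_nonexpansive: "\<And>i u v. i \<in> {1..n} \<Longrightarrow> norm (T i u - T i v) \<le> norm (u - v)"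
    and P_nonexpansive: "\<And>u v. norm (P u - P v) \<le> norm (u - v)"
begin

text \<open>The state is the table alone, with the mean recomputed at each step;
  \<open>dfinito_sweep_eq\<close> shows that the tracked mean of the algorithm agrees with
  it.\<close>

primrec sweep :: "nat \<Rightarrow> (nat \<Rightarrow> 'a) \<Rightarrow> nat \<Rightarrow> 'a" where
  "sweep 0 z = z"
| "sweep (Suc j) z = (sweep j z)(\<pi> (Suc j) := T (\<pi> (Suc j)) (P (average n (sweep j z))))"

definition relax :: "real \<Rightarrow> (nat \<Rightarrow> 'a) \<Rightarrow> nat \<Rightarrow> 'a"
  where "relax \<theta> z = (\<lambda>i. (1 - \<theta>) *\<^sub>R z i + \<theta> *\<^sub>R sweep n z i)"

abbreviation N :: "(nat \<Rightarrow> 'a) \<Rightarrow> real"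
  where "N \<equiv> order_norm n \<pi>"

lemma perm_eq_iff [simp]: "\<pi> i = \<pi> j \<longleftrightarrow> i = j"
  using permutes_inj[OF perm] by (auto dest: injD)

lemma TP_nonexpansive: "i \<in> {1..n} \<Longrightarrow> norm (T (\<pi> i) (P u) - T (\<pi> i) (P v)) \<le> norm (u - v)"
  using permutes_in_image[OF perm] by (meson P_nonexpansive T_nonexpansive order_trans)

text \<open>By injectivity of \<open>\<pi>\<close>, the entry \<open>\<pi> i\<close> is written only
  at step \<open>i\<close> and keeps that value. Steps are counted from 1, so \<open>\<pi> 0\<close>
  is never written, hence the bound on \<open>i\<close>.\<close>

lemma sweep_perm:
  "1 \<le> i \<Longrightarrow>
    sweep j z (\<pi> i) = (if i \<le> j then T (\<pi> i) (P (average n (sweep (i - 1) z))) else z (\<pi> i))"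
  by (induction j) (auto simp: le_Suc_eq)

lemma sweep_fixpoint:
  assumes "\<And>i. i \<in> {1..n} \<Longrightarrow> T i (P (average n z)) = z i" and "j \<le> n"
  shows "sweep j z = z"
  using assms(2) by (induction j) (use assms(1) permutes_in_image[OF perm] in auto)

text \<open>The weights after \<open>j\<close> updates: cyclically shifted so that the component
  updated next always has the smallest weight \<open>1 / n\<close>. One update then costs the other components
  \<open>1 / n\<close> each, which pays for the new component by Jensen's inequality.\<close>

definition weight :: "nat \<Rightarrow> nat \<Rightarrow> real"
  where "weight j i = (if i \<le> j then real i + real n - real j else real i - real j) / real n"

lemma weighted_norm_decreases:
  assumes j: "j < n"
  shows "(\<Sum>i\<in>{1..n}. weight (Suc j) i * (norm (sweep (Suc j) y (\<pi> i) - sweep (Suc j) z (\<pi> i)))\<^sup>2)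
    \<le> (\<Sum>i\<in>{1..n}. weight j i * (norm (sweep j y (\<pi> i) - sweep j z (\<pi> i)))\<^sup>2)"
proof -
  define d where "d i = (norm (sweep j y (\<pi> i) - sweep j z (\<pi> i)))\<^sup>2" for i
  define d' where "d' i = (norm (sweep (Suc j) y (\<pi> i) - sweep (Suc j) z (\<pi> i)))\<^sup>2" for i
  \<comment> \<open>At \<open>i = Suc j\<close> the weight rises from \<open>1 / n\<close> to 1: the
    two old terms cancel and the new distance stays. Every other weight drops by
    \<open>1 / n\<close>.\<close>
  have eq: "weight (Suc j) i * d' i
      = weight j i * d i - d i / real n + (if i = Suc j then d' i else 0)"
    if "i \<in> {1..n}" for i
  proof (cases "i = Suc j")
    case True
    with n_pos show ?thesis
      by (simp add: weight_def)
  next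
    case False
    then have "d' i = d i" and "weight (Suc j) i = weight j i - 1 / real n"
      using n_pos by (auto simp: d_def d'_def weight_def field_simps)
    then have "weight (Suc j) i * d' i = (weight j i - 1 / real n) * d i"
      by simp
    with False show ?thesis
      by (simp add: left_diff_distrib)
  qed
  have "norm (sweep (Suc j) y (\<pi> (Suc j)) - sweep (Suc j) z (\<pi> (Suc j)))
      \<le> norm (average n (\<lambda>i. sweep j y i - sweep j z i))"
    using TP_nonexpansive[of "Suc j"] j by (simp add: flip: average_diff)
  then have "d' (Suc j) \<le> (norm (average n (\<lambda>i. sweep j y i - sweep j z i)))\<^sup>2"
    unfolding d'_def by (intro power_mono) auto
  also have "\<dots> = (norm (average n (\<lambda>i. sweep j y (\<pi> i) - sweep j z (\<pi> i))))\<^sup>2"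
    using average_permute[OF perm, of "\<lambda>i. sweep j y i - sweep j z i"] by simp
  also have "\<dots> \<le> (1 / real n) * (\<Sum>i\<in>{1..n}. d i)"
    unfolding d_def by (rule norm_average_power2_le)
  finally have new: "d' (Suc j) \<le> (\<Sum>i\<in>{1..n}. d i / real n)"
    by (simp add: sum_divide_distrib)
  have "(\<Sum>i\<in>{1..n}. weight (Suc j) i * d' i)
      = (\<Sum>i\<in>{1..n}. weight j i * d i - d i / real n + (if i = Suc j then d' i else 0))"
    by (intro sum.cong refl eq)
  also have "\<dots> = (\<Sum>i\<in>{1..n}. weight j i * d i) - (\<Sum>i\<in>{1..n}. d i / real n) + d' (Suc j)"
    using j by (simp add: sum.distrib sum_subtractf)
  finally have "(\<Sum>i\<in>{1..n}. weight (Suc j) i * d' i)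
      = (\<Sum>i\<in>{1..n}. weight j i * d i) - (\<Sum>i\<in>{1..n}. d i / real n) + d' (Suc j)" .
  then show ?thesis
    using new unfolding d_def d'_def by linarith
qed

text \<open>On \<open>{1..n}\<close> the weights at steps 0 and \<open>n\<close> are both
  \<open>i / n\<close>, so the decreases chained over one sweep compare values of the same
  norm.\<close>

lemma sweep_nonexpansive: "N (\<lambda>i. sweep n y i - sweep n z i) \<le> N (\<lambda>i. y i - z i)"
proof (rule power2_le_imp_le[OF _ order_norm_nonneg])
  have "(\<Sum>i\<in>{1..n}. weight j i * (norm (sweep j y (\<pi> i) - sweep j z (\<pi> i)))\<^sup>2)
      \<le> (\<Sum>i\<in>{1..n}. weight 0 i * (norm (y (\<pi> i) - z (\<pi> i)))\<^sup>2)" if "j \<le> n" for j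
    using that
  proof (induction j)
    case (Suc j)
    then show ?case
      using weighted_norm_decreases[of j y z] by (simp del: sweep.simps)
  qed simp
  from this[of n] show "(N (\<lambda>i. sweep n y i - sweep n z i))\<^sup>2 \<le> (N (\<lambda>i. y i - z i))\<^sup>2"
    by (simp add: order_norm_power2 weight_def cong: sum.cong_simp)
qed

section \<open>The Krasnoselskii-Mann iteration of the sweep\<close>

lemma relax_residual_le:
  assumes "0 \<le> \<theta>" "\<theta> \<le> 1"
  shows "N (\<lambda>i. relax \<theta> z i - sweep n (relax \<theta> z) i) \<le> N (\<lambda>i. z i - sweep n z i)"
proof -
  \<comment> \<open>The new residual splits into \<open>1 - \<theta>\<close> times the old one and a
    difference of two sweeps; nonexpansiveness bounds the latter by the displacement, which is
    \<open>\<theta>\<close> times the old residual.\<close>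
  have "N (\<lambda>i. relax \<theta> z i - sweep n (relax \<theta> z) i)
      = N (\<lambda>i. (1 - \<theta>) *\<^sub>R (z i - sweep n z i) + (sweep n z i - sweep n (relax \<theta> z) i))"
    by (intro arg_cong[of _ _ N] ext) (simp add: relax_def algebra_simps)
  also have "\<dots> \<le> (1 - \<theta>) * N (\<lambda>i. z i - sweep n z i) + N (\<lambda>i. z i - relax \<theta> z i)"
    using order_norm_triangle[of n \<pi> "\<lambda>i. (1 - \<theta>) *\<^sub>R (z i - sweep n z i)"
        "\<lambda>i. sweep n z i - sweep n (relax \<theta> z) i"]
      sweep_nonexpansive[of z "relax \<theta> z"] assms
    by (simp add: order_norm_scaleR)
  also have "N (\<lambda>i. z i - relax \<theta> z i) = N (\<lambda>i. \<theta> *\<^sub>R (z i - sweep n z i))"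
    by (intro arg_cong[of _ _ N] ext) (simp add: relax_def algebra_simps)
  also have "\<dots> = \<theta> * N (\<lambda>i. z i - sweep n z i)"
    using assms by (simp add: order_norm_scaleR)
  finally show ?thesis
    by (simp add: algebra_simps)
qed

text \<open>Both \<open>z\<close> and its sweep are measured from the fixed point \<open>s\<close>;
  in the identity for relaxed squares, the term for their difference is then the residual.\<close>

lemma relax_distance_decrease:
  assumes \<theta>: "0 \<le> \<theta>" and fixpoint: "sweep n s = s"
  shows "(N (\<lambda>i. relax \<theta> z i - s i))\<^sup>2 + \<theta> * (1 - \<theta>) * (N (\<lambda>i. z i - sweep n z i))\<^sup>2
    \<le> (N (\<lambda>i. z i - s i))\<^sup>2"
proof -
  have "N (\<lambda>i. relax \<theta> z i - s i) = N (\<lambda>i. (1 - \<theta>) *\<^sub>R (z i - s i) + \<theta> *\<^sub>R (sweep n z i - s i))"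
    by (intro arg_cong[of _ _ N] ext) (simp add: relax_def algebra_simps)
  then have "(N (\<lambda>i. relax \<theta> z i - s i))\<^sup>2
      = (1 - \<theta>) * (N (\<lambda>i. z i - s i))\<^sup>2 + \<theta> * (N (\<lambda>i. sweep n z i - s i))\<^sup>2
        - \<theta> * (1 - \<theta>) * (N (\<lambda>i. z i - sweep n z i))\<^sup>2"
    by (simp add: order_norm_relax_power2)
  moreover have "\<theta> * (N (\<lambda>i. sweep n z i - s i))\<^sup>2 \<le> \<theta> * (N (\<lambda>i. z i - s i))\<^sup>2"
    using sweep_nonexpansive[of z s] \<theta>
    by (intro mult_left_mono power_mono) (simp_all add: fixpoint order_norm_nonneg)
  ultimately show ?thesis
    by (simp add: algebra_simps)
qed

lemma relax_residual_rate:
  fixes z0 :: "nat \<Rightarrow> 'a"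
  assumes \<theta>: "0 \<le> \<theta>" "\<theta> \<le> 1" and fixpoint: "sweep n s = s"
  defines "z \<equiv> \<lambda>k. (relax \<theta> ^^ k) z0"
  shows "real (Suc k) * (\<theta> * (1 - \<theta>)) * (N (\<lambda>i. z k i - sweep n (z k) i))\<^sup>2
    \<le> (N (\<lambda>i. z0 i - s i))\<^sup>2"
proof -
  \<comment> \<open>Keeping the distance term makes the decreases telescope; monotonicity of the
    residuals lets the latest one stand for all \<open>Suc k\<close> of them.\<close>
  have "real (Suc k) * (\<theta> * (1 - \<theta>)) * (N (\<lambda>i. z k i - sweep n (z k) i))\<^sup>2
      + (N (\<lambda>i. z (Suc k) i - s i))\<^sup>2 \<le> (N (\<lambda>i. z0 i - s i))\<^sup>2"
  proof (induction k)
    case 0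
    show ?case
      using relax_distance_decrease[OF \<theta>(1) fixpoint, of z0] by (simp add: z_def)
  next
    case (Suc k)
    have "(N (\<lambda>i. z (Suc k) i - sweep n (z (Suc k)) i))\<^sup>2 \<le> (N (\<lambda>i. z k i - sweep n (z k) i))\<^sup>2"
      using relax_residual_le[OF \<theta>, of "z k"]
      by (intro power_mono order_norm_nonneg) (simp add: z_def)
    then have "real (Suc k) * (\<theta> * (1 - \<theta>)) * (N (\<lambda>i. z (Suc k) i - sweep n (z (Suc k)) i))\<^sup>2
        \<le> real (Suc k) * (\<theta> * (1 - \<theta>)) * (N (\<lambda>i. z k i - sweep n (z k) i))\<^sup>2"
      using \<theta> by (intro mult_left_mono) auto
    moreover have "(N (\<lambda>i. z (Suc (Suc k)) i - s i))\<^sup>2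
        + \<theta> * (1 - \<theta>) * (N (\<lambda>i. z (Suc k) i - sweep n (z (Suc k)) i))\<^sup>2
        \<le> (N (\<lambda>i. z (Suc k) i - s i))\<^sup>2"
      using relax_distance_decrease[OF \<theta>(1) fixpoint, of "z (Suc k)"] by (simp add: z_def)
    moreover have "real (Suc (Suc k)) * c = real (Suc k) * c + c" for c
      by (simp add: algebra_simps)
    ultimately show ?case
      using Suc.IH by (simp only: distrib_right)
  qed
  then show ?thesis
    using zero_le_power2[of "N (\<lambda>i. z (Suc k) i - s i)"] by linarith
qed

section \<open>From the sweep residual to the optimality residual\<close>

lemma mean_residual_bound:
  "(norm (average n (\<lambda>i. z i - T i (P (average n z)))))\<^sup>2
    \<le> 4 * ((ln (real n) + 1) / real n) * (N (\<lambda>i. z i - sweep n z i))\<^sup>2"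
proof -
  define w where "w i = norm (z (\<pi> i) - sweep n z (\<pi> i))" for i
  define W where "W = (\<Sum>i\<in>{1..n}. w i)"
  \<comment> \<open>During the sweep, entry \<open>\<pi> i\<close> is computed from the average
    after \<open>i - 1\<close> updates instead of the initial one; \<open>W / real n\<close> bounds
    the effect of that delay.\<close>
  have drift: "norm (z (\<pi> i) - T (\<pi> i) (P (average n z))) \<le> w i + W / real n"
    if i: "i \<in> {1..n}" for i
  proof -
    have "norm (sweep n z (\<pi> i) - T (\<pi> i) (P (average n z)))
        \<le> norm (average n (\<lambda>l. sweep (i - 1) z l - z l))"
      using TP_nonexpansive[OF i] i by (simp add: sweep_perm flip: average_diff)
    also have "\<dots> = norm (average n (\<lambda>l. sweep (i - 1) z (\<pi> l) - z (\<pi> l)))"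
      using average_permute[OF perm, of "\<lambda>l. sweep (i - 1) z l - z l"] by simp
    also have "\<dots> \<le> (1 / real n) * (\<Sum>l\<in>{1..n}. norm (sweep (i - 1) z (\<pi> l) - z (\<pi> l)))"
      by (rule norm_average_le)
    \<comment> \<open>Midway through the sweep an entry has either its initial or its final value,
      so it contributes 0 or \<open>w l\<close>.\<close>
    also have "\<dots> \<le> (1 / real n) * W"
      unfolding W_def w_def using i
      by (intro mult_left_mono sum_mono) (auto simp: sweep_perm norm_minus_commute)
    finally have "norm (sweep n z (\<pi> i) - T (\<pi> i) (P (average n z))) \<le> W / real n"
      by simp
    then show ?thesis
      using norm_triangle_ineq[of "z (\<pi> i) - sweep n z (\<pi> i)"
          "sweep n z (\<pi> i) - T (\<pi> i) (P (average n z))"]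
      by (simp add: w_def)
  qed
  have "norm (average n (\<lambda>i. z i - T i (P (average n z))))
      = norm (average n (\<lambda>i. z (\<pi> i) - T (\<pi> i) (P (average n z))))"
    using average_permute[OF perm, of "\<lambda>i. z i - T i (P (average n z))"] by simp
  also have "\<dots> \<le> (1 / real n) * (\<Sum>i\<in>{1..n}. norm (z (\<pi> i) - T (\<pi> i) (P (average n z))))"
    by (rule norm_average_le)
  also have "\<dots> \<le> (1 / real n) * (\<Sum>i\<in>{1..n}. w i + W / real n)"
    by (intro mult_left_mono sum_mono drift) auto
  \<comment> \<open>The residuals themselves and their drifts contribute \<open>W\<close> each;
    squaring this 2 gives the factor 4.\<close>
  also have "\<dots> = 2 / real n * W"
    using n_pos by (simp add: sum.distrib W_def)
  finally have "(norm (average n (\<lambda>i. z i - T i (P (average n z)))))\<^sup>2 \<le> (2 / real n * W)\<^sup>2"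
    by (rule power_mono) simp
  also have "\<dots> = (2 / real n)\<^sup>2 * W\<^sup>2"
    by (rule power_mult_distrib)
  also have "\<dots> \<le> (2 / real n)\<^sup>2
      * (real n * (ln (real n) + 1) * (N (\<lambda>i. z i - sweep n z i))\<^sup>2)"
    unfolding W_def w_def
    by (intro mult_left_mono sum_le_harmonic_order_norm[OF n_pos]) simp
  also have "\<dots> = 4 * ((ln (real n) + 1) / real n) * (N (\<lambda>i. z i - sweep n z i))\<^sup>2"
    using n_pos by (simp add: power2_eq_square field_simps)
  finally show ?thesis .
qed

section \<open>Prox-DFinito as a relaxed sweep\<close>

lemma dfinito_sweep_eq:
  assumes T: "T = (\<lambda>i u. u - \<alpha> *\<^sub>R gradient (f i) u)" and P: "P = prox \<alpha> r"
    and cyclic: "cyclic_sampling n \<pi> idx" and "j \<le> n"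
  shows "dfinito_sweep n \<alpha> f r idx k j (z, average n z) = (sweep j z, average n (sweep j z))"
proof -
  \<comment> \<open>The incremental correction of the tracked mean is exactly the change of the
    average, so states keep the form \<open>(y, average n y)\<close>.\<close>
  have step: "dfinito_step n \<alpha> f r i (y, average n y)
      = (y(i := T i (P (average n y))), average n (y(i := T i (P (average n y)))))"
    if "i \<in> {1..n}" for i y
    by (simp add: dfinito_step_def Let_def T P average_update[OF that])
  show ?thesis
    using \<open>j \<le> n\<close>
  proof (induction j)
    case (Suc j)
    then have j: "Suc j \<in> {1..n}"
      by simp
    with cyclic have "idx (k * n + Suc j) = \<pi> (Suc j)"
      unfolding cyclic_sampling_def by blast
    moreover have "\<pi> (Suc j) \<in> {1..n}"
      using j permutes_in_image[OF perm] by blast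
    ultimately show ?case
      using Suc step by (simp add: fun_upd_def)
  qed simp
qed

lemma dfinito_epoch_eq:
  assumes "T = (\<lambda>i u. u - \<alpha> *\<^sub>R gradient (f i) u)" and "P = prox \<alpha> r"
    and "cyclic_sampling n \<pi> idx"
  shows "dfinito_epoch n \<alpha> \<theta> f r idx z0 k
    = ((relax \<theta> ^^ k) z0, average n ((relax \<theta> ^^ k) z0))"
proof (induction k)
  case (Suc k)
  then show ?case
    by (simp add: Let_def damp_def dfinito_sweep_eq[OF assms] relax_def average_relax)
qed simp

end

subsection \<open>Convergence rate\<close>

theorem theorem1:
  fixes n :: nat
    and f :: "nat \<Rightarrow> real ^ 'd \<Rightarrow> real"
    and F :: "real ^ 'd \<Rightarrow> real"
    and r :: "real ^ 'd \<Rightarrow> ereal"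
    and L \<alpha> \<theta> C :: real
    and \<pi> idx :: "nat \<Rightarrow> nat"
    and z0 zstar :: "nat \<Rightarrow> real ^ 'd"
    and xstar :: "real ^ 'd"
    and x :: "nat \<Rightarrow> real ^ 'd"
  assumes "n \<ge> 1"
    and "L > 0"
    and "\<And>i. i \<in> {1..n} \<Longrightarrow> convex_on UNIV (f i)"
    and "\<And>i. i \<in> {1..n} \<Longrightarrow> L_smooth L (f i)"
    and "F = (\<lambda>y. 1 / real n * (\<Sum>i\<in>{1..n}. f i y))"
    and "ext_convex r" and "ext_closed r" and "ext_proper r"
    and "0 < \<alpha>" and "\<alpha> \<le> 2 / L"
    and "0 < \<theta>" and "\<theta> < 1"
    and "\<pi> permutes {1..n}"
    and "is_arg_min (\<lambda>y. ereal (F y) + r y) (\<lambda>_. True) xstar"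
    and "\<And>i. i \<in> {1..n} \<Longrightarrow> zstar i = xstar - \<alpha> *\<^sub>R gradient (f i) xstar"
    and "cyclic_sampling n \<pi> idx"
    and "x = prox_dfinito n \<alpha> \<theta> f r idx z0"
    and "C = (2 / (\<alpha> * L))\<^sup>2 * ((ln (real n) + 1) / real n)
               * (order_norm n \<pi> (\<lambda>i. z0 i - zstar i))\<^sup>2"
  shows "\<forall>k. \<exists>g. is_arg_min (\<lambda>h. (norm (gradient F (x (k * n)) + h))\<^sup>2)
                    (\<lambda>h. h \<in> subdifferential r (x (k * n))) g
               \<and> (norm (gradient F (x (k * n)) + g))\<^sup>2
                   \<le> C * L\<^sup>2 / ((real k + 1) * \<theta> * (1 - \<theta>))"
proof
  fix k
  define T where "T = (\<lambda>i u. u - \<alpha> *\<^sub>R gradient (f i) u)"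
  define P where "P = prox \<alpha> r"
  have G: "GDERIV (f i) u :> gradient (f i) u" if "i \<in> {1..n}" for i u
    using assms(4)[OF that] by (intro GDERIV_gradient) (simp add: L_smooth_def)
  have dF: "GDERIV F u :> average n (\<lambda>i. gradient (f i) u)" for u
  proof -
    have "GDERIV (\<lambda>y. \<Sum>i\<in>{1..n}. f i y) u :> (\<Sum>i\<in>{1..n}. gradient (f i) u)"
      by (intro GDERIV_sum G)
    from GDERIV_mult[OF GDERIV_const[of "1 / real n"] this]
    show ?thesis
      by (simp add: assms(5) average_def)
  qed
  then have gradF: "gradient F u = average n (\<lambda>i. gradient (f i) u)" for u
    by (rule gradient_eqI)
  \<comment> \<open>Besides expressing optimality, this subgradient guarantees that all proximal
    minimizers exist.\<close>
  have gstar: "- gradient F xstar \<in> subdifferential r xstar"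
    unfolding gradF using assms(14)
    by (intro minimizer_imp_subgradient[OF assms(6,8) dF]) (simp add: is_arg_min_def not_less)
  have P_subgradient: "(1 / \<alpha>) *\<^sub>R (u - P u) \<in> subdifferential r (P u)" for u
    unfolding P_def by (rule prox_subgradient[OF assms(6-9) gstar])
  interpret nonexpansive_sweep n \<pi> T P
  proof
    show "norm (T i u - T i v) \<le> norm (u - v)" if "i \<in> {1..n}" for i u v
      unfolding T_def using assms(4)[OF that]
      by (intro gradient_step_nonexpansive[OF assms(3)[OF that] G[OF that] _ assms(2,9,10)])
         (simp add: L_smooth_def)
    show "norm (P u - P v) \<le> norm (u - v)" for u v
      by (rule resolvent_nonexpansive[OF assms(8,9) P_subgradient P_subgradient])
  qed fact+
  \<comment> \<open>Taken at \<open>u = P (average n z)\<close>, this mean is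
    \<open>\<alpha>\<close> times the gradient plus the subgradient supplied by the proximal
    step.\<close>
  have mean_T: "average n (\<lambda>i. z i - T i u) = average n z - u + \<alpha> *\<^sub>R gradient F u" for z u
    using assms(1)
    by (simp add: T_def gradF average_def sum.distrib sum_subtractf scaleR_sum_right
        algebra_simps sum_constant_scaleR del: sum_constant)
  have "sweep n zstar = zstar"
  proof (rule sweep_fixpoint)
    have "average n (\<lambda>i. zstar i - T i xstar) = 0"
      unfolding average_def using assms(15) by (simp add: T_def)
    then have "average n zstar - xstar = \<alpha> *\<^sub>R - gradient F xstar"
      unfolding mean_T by (simp add: add_eq_0_iff2)
    then have "(1 / \<alpha>) *\<^sub>R (average n zstar - xstar) \<in> subdifferential r xstar"
      using gstar assms(9) by simp
    \<comment> \<open>Both arguments of the resolvent are \<open>average n zstar\<close>, so the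
      bound is 0 and the two solutions coincide.\<close>
    from resolvent_nonexpansive[OF assms(8,9) P_subgradient this, of "average n zstar"]
    have "P (average n zstar) = xstar"
      by simp
    then show "T i (P (average n zstar)) = zstar i" if "i \<in> {1..n}" for i
      using assms(15)[OF that] by (simp add: T_def)
  qed simp
  define z where "z = (relax \<theta> ^^ k) z0"
  define D where "D = (order_norm n \<pi> (\<lambda>i. z0 i - zstar i))\<^sup>2"
  define R where "R = (order_norm n \<pi> (\<lambda>i. z i - sweep n z i))\<^sup>2"
  have rate: "R \<le> D / ((real k + 1) * \<theta> * (1 - \<theta>))"
    using relax_residual_rate[OF _ _ \<open>sweep n zstar = zstar\<close>, of \<theta> k z0] assms(11,12)
    by (simp add: R_def D_def z_def pos_le_divide_eq mult_ac add.commute)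
  define w where "w = x (k * n)"
  \<comment> \<open>Time \<open>k * n\<close> lies zero steps into epoch \<open>k\<close>, so the
    damped state enters the proximal operator directly.\<close>
  have w: "w = P (average n z)"
    using assms(1) dfinito_epoch_eq[OF T_def P_def assms(16)]
    by (simp add: w_def assms(17) prox_dfinito_def z_def P_def)
  define g where "g = (1 / \<alpha>) *\<^sub>R (average n z - w)"
  have g: "g \<in> subdifferential r w"
    unfolding g_def w by (rule P_subgradient)
  have "average n (\<lambda>i. z i - T i w) = \<alpha> *\<^sub>R (gradient F w + g)"
    using assms(9) by (simp add: mean_T g_def algebra_simps)
  then have "\<alpha>\<^sup>2 * (norm (gradient F w + g))\<^sup>2 \<le> 4 * ((ln (real n) + 1) / real n) * R"
    using mean_residual_bound[of z] by (simp add: w R_def power_mult_distrib)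
  also have "\<dots> \<le> 4 * ((ln (real n) + 1) / real n) * (D / ((real k + 1) * \<theta> * (1 - \<theta>)))"
    using assms(1) by (intro mult_left_mono rate) simp
  \<comment> \<open>The factor \<open>L\<^sup>2\<close> cancels the \<open>L\<close> inside
    \<open>C\<close>, leaving \<open>4 / \<alpha>\<^sup>2\<close>.\<close>
  also have "\<dots> = \<alpha>\<^sup>2 * (C * L\<^sup>2 / ((real k + 1) * \<theta> * (1 - \<theta>)))"
    unfolding assms(18) using assms(2,9) by (simp add: D_def power_divide power_mult_distrib)
  finally have bound:
    "(norm (gradient F w + g))\<^sup>2 \<le> C * L\<^sup>2 / ((real k + 1) * \<theta> * (1 - \<theta>))"
    by (rule mult_left_le_imp_le) (use assms(9) in simp)
  \<comment> \<open>The minimizing subgradient is a point of the closed subdifferential nearest to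
    \<open>- gradient F w\<close>; \<open>g\<close> shows that the set is nonempty and bounds the
    minimum.\<close>
  obtain h where h: "h \<in> subdifferential r w"
      "\<And>v. v \<in> subdifferential r w \<Longrightarrow> dist (- gradient F w) h \<le> dist (- gradient F w) v"
    using distance_attains_inf[OF closed_subdifferential[OF assms(8)], of w] g by blast
  have "dist (- gradient F w) v = norm (gradient F w + v)" for v
    using norm_minus_cancel[of "gradient F w + v"] by (simp add: dist_norm)
  then have min: "(norm (gradient F w + h))\<^sup>2 \<le> (norm (gradient F w + v))\<^sup>2"
    if "v \<in> subdifferential r w" for v
    using h(2)[OF that] by (intro power_mono) auto
  with h(1) have "is_arg_min (\<lambda>h. (norm (gradient F w + h))\<^sup>2) (\<lambda>h. h \<in> subdifferential r w) h"
    by (simp add: is_arg_min_def not_less)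
  moreover have "(norm (gradient F w + h))\<^sup>2 \<le> C * L\<^sup>2 / ((real k + 1) * \<theta> * (1 - \<theta>))"
    using min[OF g] bound by linarith
  ultimately show "\<exists>g. is_arg_min (\<lambda>h. (norm (gradient F (x (k * n)) + h))\<^sup>2)
                    (\<lambda>h. h \<in> subdifferential r (x (k * n))) g
               \<and> (norm (gradient F (x (k * n)) + g))\<^sup>2
                   \<le> C * L\<^sup>2 / ((real k + 1) * \<theta> * (1 - \<theta>))"
    unfolding w_def by blast
qed

end
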